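(* Suppose that each player in an $n$-player potential game employs FTRL (with simultaneous updates) with constant learning rate $\eta\le 1/L$, where $L>0$ is the smoothness parameter of the potential $\Phi$. Then for every $t\ge1$, $$\Phi(\boldsymbol{x}^{(t+1)})-\Phi(\boldsymbol{x}^{(t)})\ge\frac{1}{2\eta}\|\boldsymbol{x}^{(t+1)}-\boldsymbol{x}^{(t)}\|^2 .$$ In particular, for every $T\ge 1$, $$\sum_{t=1}^T\sum_{i=1}^n\|\boldsymbol{x}_i^{(t+1)}-\boldsymbol{x}_i^{(t)}\|_{(i)}^2\le 2\eta\,\Phi_{\mathrm{range}} .$$
   Context: Players $i\in[n]$ have strategy sets $\mathcal{X}_i=\Delta(\mathcal{A}_i)$ with $\mathcal{A}_i$ finite. The game is a potential game with (multilinear, continuously differentiable) potential $\Phi:\prod_i\mathcal{X}_i\to\mathbb{R}$: $u_i(\boldsymbol{x}_i,\boldsymbol{x}_{-i})-u_i(\boldsymbol{x}_i',\boldsymbol{x}_{-i})=\Phi(\boldsymbol{x}_i,\boldsymbol{x}_{-i})-\Phi(\boldsymbol{x}_i',\boldsymbol{x}_{-i})$; the utility vector of player $i$ at round $t$ is $\boldsymbol{u}_i^{(t)}=\nabla_{\boldsymbol{x}_i}\Phi(\boldsymbol{x}^{(t)})$. $\Phi_{\mathrm{range}}=\max\Phi-\min\Phi$. Each player $i$ has a regularizer $\mathcal{R}_i$ on $\mathcal{X}_i$ that is continuously differentiable (on an open set containing $\mathcal{X}_i$) and $1$-strongly convex with respect to a norm $\|\cdot\|_{(i)}$. The global norm is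 $\|\boldsymbol{x}\|=\sqrt{\sum_i\|\boldsymbol{x}_i\|_{(i)}^2}$, with dual norm $\|\cdot\|_*$, and $\Phi$ is $L$-smooth: $\|\nabla\Phi(\boldsymbol{x})-\nabla\Phi(\boldsymbol{x}')\|_*\le L\|\boldsymbol{x}-\boldsymbol{x}'\|$ for all $\boldsymbol{x},\boldsymbol{x}'$. FTRL with constant learning rate $\eta>0$: $\boldsymbol{x}_i^{(t+1)}=\arg\max_{\boldsymbol{x}_i\in\mathcal{X}_i}\{\langle\boldsymbol{x}_i,\sum_{\tau=1}^t\boldsymbol{u}_i^{(\tau)}\rangle-\frac1\eta\mathcal{R}_i(\boldsymbol{x}_i)\}$ for all $t\ge0$ (so $\boldsymbol{x}_i^{(1)}$ minimizes $\mathcal{R}_i$). *)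

theory Defs
  imports "HOL-Analysis.Analysis"
begin

(* Players are the elements of a finite type 'p (so n = CARD('p)).  The action set of player i is a
   subset A i of a finite type 'a, so that different players may have different numbers of actions.
   R^(A i) is the space of vectors supported on A i; a strategy profile is x :: real^'a^'p, with
   x $ i the mixed strategy of player i. *)

definition coord_space :: "'a::finite set \<Rightarrow> (real^'a) set" where
  "coord_space B = {v. \<forall>a. a \<notin> B \<longrightarrow> v $ a = 0}"

definition mixed_strategies :: "'a::finite set \<Rightarrow> (real^'a) set" where
  "mixed_strategies B = {v \<in> coord_space B. (\<forall>a\<in>B. 0 \<le> v $ a) \<and> (\<Sum>a\<in>B. v $ a) = 1}"

definition joint_space :: "('p::finite \<Rightarrow> 'a::finite set) \<Rightarrow> (real^'a^'p) set" where
  "joint_space A = {x. \<forall>i. x $ i \<in> coord_space (A i)}"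

definition profiles :: "('p::finite \<Rightarrow> 'a::finite set) \<Rightarrow> (real^'a^'p) set" where
  "profiles A = {x. \<forall>i. x $ i \<in> mixed_strategies (A i)}"

text \<open>The profile \<open>(y, x\<^sub>-\<^sub>i)\<close>:\<close>

definition replace :: "real^'a::finite^'p::finite \<Rightarrow> 'p \<Rightarrow> real^'a \<Rightarrow> real^'a^'p" where
  "replace x i y = (\<chi> j. if j = i then y else x $ j)"

definition pure_profile :: "('p::finite \<Rightarrow> 'a::finite) \<Rightarrow> real^'a^'p" where
  "pure_profile s = (\<chi> i. axis (s i) 1)"

text \<open>Multilinearity of a function on a product of simplices: its value at a mixed profile is the
  expectation of its values at pure profiles.\<close>

definition multilinear_on_profiles ::
    "('p::finite \<Rightarrow> 'a::finite set) \<Rightarrow> (real^'a^'p \<Rightarrow> real) \<Rightarrow> bool" where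
  "multilinear_on_profiles A \<Phi> \<longleftrightarrow>
     (\<forall>x\<in>profiles A. \<Phi> x = (\<Sum>s\<in>Pi\<^sub>E UNIV A. (\<Prod>i\<in>UNIV. x $ i $ s i) * \<Phi> (pure_profile s)))"

definition potential_game ::
    "('p::finite \<Rightarrow> 'a::finite set) \<Rightarrow> ('p \<Rightarrow> real^'a^'p \<Rightarrow> real) \<Rightarrow> (real^'a^'p \<Rightarrow> real) \<Rightarrow> bool" where
  "potential_game A u \<Phi> \<longleftrightarrow>
     (\<forall>i. \<forall>x\<in>profiles A. \<forall>y\<in>mixed_strategies (A i).
        u i x - u i (replace x i y) = \<Phi> x - \<Phi> (replace x i y))"

text \<open>The maximum and minimum of a continuous \<open>\<Phi>\<close> over the compact set of profiles are its
  supremum and infimum.\<close>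

definition potential_range ::
    "('p::finite \<Rightarrow> 'a::finite set) \<Rightarrow> (real^'a^'p \<Rightarrow> real) \<Rightarrow> real" where
  "potential_range A \<Phi> = (SUP x\<in>profiles A. \<Phi> x) - (INF x\<in>profiles A. \<Phi> x)"

definition gradient :: "('b::euclidean_space \<Rightarrow> real) \<Rightarrow> 'b \<Rightarrow> 'b" where
  "gradient f x = (THE D. GDERIV f x :> D)"

definition C1_around :: "'b::euclidean_space set \<Rightarrow> ('b \<Rightarrow> real) \<Rightarrow> bool" where
  "C1_around S f \<longleftrightarrow>
     (\<exists>U. open U \<and> S \<subseteq> U \<and> (\<forall>x\<in>U. GDERIV f x :> gradient f x) \<and> continuous_on U (gradient f))"

definition norm_on :: "'b::real_vector set \<Rightarrow> ('b \<Rightarrow> real) \<Rightarrow> bool" where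
  "norm_on V N \<longleftrightarrow>
     (\<forall>v\<in>V. 0 \<le> N v) \<and> (\<forall>v\<in>V. N v = 0 \<longleftrightarrow> v = 0) \<and>
     (\<forall>c. \<forall>v\<in>V. N (c *\<^sub>R v) = \<bar>c\<bar> * N v) \<and>
     (\<forall>v\<in>V. \<forall>w\<in>V. N (v + w) \<le> N v + N w)"

definition global_norm :: "('p::finite \<Rightarrow> real^'a::finite \<Rightarrow> real) \<Rightarrow> real^'a^'p \<Rightarrow> real" where
  "global_norm N x = sqrt (\<Sum>i\<in>UNIV. (N i (x $ i))\<^sup>2)"

text \<open>The dual norm of a norm \<open>N\<close> on \<open>V\<close>.  Testing only against vectors of \<open>V\<close>
  makes the coordinates of gradients outside the action sets irrelevant.\<close>

definition dual_norm :: "'b::real_inner set \<Rightarrow> ('b \<Rightarrow> real) \<Rightarrow> 'b \<Rightarrow> real" where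
  "dual_norm V N g = (SUP v\<in>{v\<in>V. N v \<le> 1}. g \<bullet> v)"

definition smooth_potential ::
    "('p::finite \<Rightarrow> 'a::finite set) \<Rightarrow> ('p \<Rightarrow> real^'a \<Rightarrow> real) \<Rightarrow> real \<Rightarrow> (real^'a^'p \<Rightarrow> real) \<Rightarrow> bool" where
  "smooth_potential A N L \<Phi> \<longleftrightarrow>
     (\<forall>x\<in>profiles A. \<forall>x'\<in>profiles A.
        dual_norm (joint_space A) (global_norm N) (gradient \<Phi> x - gradient \<Phi> x')
          \<le> L * global_norm N (x - x'))"

definition strongly_convex_on :: "'b::real_vector set \<Rightarrow> ('b \<Rightarrow> real) \<Rightarrow> real \<Rightarrow> ('b \<Rightarrow> real) \<Rightarrow> bool" where
  "strongly_convex_on S N \<mu> f \<longleftrightarrow>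
     (\<forall>v\<in>S. \<forall>w\<in>S. \<forall>c\<in>{0..1}.
        f (c *\<^sub>R v + (1 - c) *\<^sub>R w)
          \<le> c * f v + (1 - c) * f w - \<mu> / 2 * c * (1 - c) * (N (v - w))\<^sup>2)"

text \<open>The utility vector of player \<open>i\<close> in round \<open>\<tau>\<close> is the \<open>i\<close>-th block
  of the gradient of \<open>\<Phi>\<close> at \<open>x \<tau>\<close>.  Rounds are numbered from 1; \<open>x 0\<close> is
  irrelevant.\<close>

definition FTRL ::
    "('p::finite \<Rightarrow> 'a::finite set) \<Rightarrow> ('p \<Rightarrow> real^'a \<Rightarrow> real) \<Rightarrow> real \<Rightarrow> (real^'a^'p \<Rightarrow> real)
      \<Rightarrow> (nat \<Rightarrow> real^'a^'p) \<Rightarrow> bool" where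
  "FTRL A R \<eta> \<Phi> x \<longleftrightarrow>
     (\<forall>t i. is_arg_max (\<lambda>y. y \<bullet> (\<Sum>\<tau>=1..t. gradient \<Phi> (x \<tau>) $ i) - 1 / \<eta> * R i y)
              (\<lambda>y. y \<in> mixed_strategies (A i)) (x (t + 1) $ i))"

end

theory Submission
  imports Defs
begin

text \<open>Strong convexity of the regularizers makes each FTRL objective grow quadratically away from
  its maximizer. Comparing the maximizers of two consecutive objectives, which differ by one linear
  term, gives \<open>\<langle>\<nabla>\<Phi>(x\<^sub>t), x\<^sub>t\<^sub>+\<^sub>1 - x\<^sub>t\<rangle> \<ge> (1/\<eta>) \<parallel>x\<^sub>t\<^sub>+\<^sub>1 - x\<^sub>t\<parallel>\<^sup>2\<close>, and by the descent lemma
  smoothness loses at most \<open>L/2 \<le> 1/(2\<eta>)\<close> of the coefficient. The second claim telescopes.\<close>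

section \<open>Norms on a subspace: equivalence with the Euclidean norm, and duality\<close>

lemma norm_on_sum_le:
  assumes N: "norm_on V N" and V: "subspace V" and "finite B" and "B \<subseteq> V"
  shows "N (\<Sum>b\<in>B. c b *\<^sub>R b) \<le> (\<Sum>b\<in>B. \<bar>c b\<bar> * N b)"
  using \<open>finite B\<close> \<open>B \<subseteq> V\<close>
proof (induction B rule: finite_induct)
  case empty
  then show ?case
    using N subspace_0[OF V] by (auto simp: norm_on_def)
next
  case (insert b B)
  have b: "b \<in> V" and B: "B \<subseteq> V"
    using insert.prems by auto
  have "(\<Sum>b\<in>B. c b *\<^sub>R b) \<in> V"
    using B by (intro subspace_sum[OF V] subspace_scale[OF V]) auto
  then have "N (c b *\<^sub>R b + (\<Sum>b\<in>B. c b *\<^sub>R b)) \<le> N (c b *\<^sub>R b) + N (\<Sum>b\<in>B. c b *\<^sub>R b)"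
    using N subspace_scale[OF V b] by (auto simp: norm_on_def)
  moreover have "N (c b *\<^sub>R b) = \<bar>c b\<bar> * N b"
    using N b by (auto simp: norm_on_def)
  ultimately show ?case
    using insert.IH[OF B] insert.hyps by simp
qed

text \<open>Expand \<open>v\<close> in an orthonormal basis of \<open>V\<close>: by Cauchy-Schwarz
  each coefficient is at most \<open>norm v\<close> in absolute value, so the sum of
  \<open>N\<close> over the basis serves as \<open>C\<close>. The basis has to lie in
  \<open>V\<close>, since nothing is known about \<open>N\<close> outside.\<close>

lemma norm_on_upper_bound:
  fixes V :: "'b::euclidean_space set"
  assumes N: "norm_on V N" and V: "subspace V"
  obtains C where "C \<ge> 0" "\<And>v. v \<in> V \<Longrightarrow> N v \<le> C * norm v"
proof -
  obtain B where B: "B \<subseteq> V" "pairwise orthogonal B" "\<And>b. b \<in> B \<Longrightarrow> norm b = 1"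
      "independent B" "span B = V"
    using orthonormal_basis_subspace[OF V] by metis
  have fin: "finite B"
    using B(4) independent_imp_finite by blast
  have N0: "0 \<le> N b" if "b \<in> B" for b
    using N B(1) that by (auto simp: norm_on_def)
  show thesis
  proof (rule that)
    show "0 \<le> (\<Sum>b\<in>B. N b)"
      by (intro sum_nonneg N0)
    fix v assume v: "v \<in> V"
    have "v = (\<Sum>b\<in>B. (v \<bullet> b) *\<^sub>R b)"
      using orthonormal_basis_expand[OF B(2) B(3) _ fin] v B(5) by simp
    then have "N v \<le> (\<Sum>b\<in>B. \<bar>v \<bullet> b\<bar> * N b)"
      using norm_on_sum_le[OF N V fin B(1), of "\<lambda>b. v \<bullet> b"] by simp
    also have "\<dots> \<le> (\<Sum>b\<in>B. norm v * N b)"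
    proof (intro sum_mono mult_right_mono N0)
      fix b assume "b \<in> B"
      then show "\<bar>v \<bullet> b\<bar> \<le> norm v"
        using Cauchy_Schwarz_ineq2[of v b] B(3) by simp
    qed
    finally show "N v \<le> (\<Sum>b\<in>B. N b) * norm v"
      by (simp add: sum_distrib_left mult.commute)
  qed
qed

text \<open>The reverse triangle inequality, combined with the upper bound, makes \<open>N\<close>
  Lipschitz for the Euclidean distance.\<close>

lemma norm_on_continuous_on:
  fixes V :: "'b::euclidean_space set"
  assumes N: "norm_on V N" and V: "subspace V"
  shows "continuous_on V N"
proof -
  obtain C where C: "C \<ge> 0" "\<And>v. v \<in> V \<Longrightarrow> N v \<le> C * norm v"
    using norm_on_upper_bound[OF assms] by metis
  have le: "N v - N w \<le> C * dist v w" if vw: "v \<in> V" "w \<in> V" for v w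
  proof -
    have d: "v - w \<in> V"
      using V vw by (rule subspace_diff)
    then have "N (v - w + w) \<le> N (v - w) + N w"
      using N vw unfolding norm_on_def by blast
    then show ?thesis
      using C(2)[OF d] by (simp add: dist_norm)
  qed
  have "C-lipschitz_on V N"
  proof (rule lipschitz_onI[OF _ C(1)])
    fix v w assume "v \<in> V" "w \<in> V"
    then show "dist (N v) (N w) \<le> C * dist v w"
      using le[of v w] le[of w v] by (auto simp: dist_real_def dist_commute)
  qed
  then show ?thesis
    by (rule lipschitz_on_continuous_on)
qed

text \<open>\<open>N\<close> is continuous and positive on the Euclidean unit sphere of
  \<open>V\<close>, so compactness gives a positive minimum there, and homogeneity carries it to all
  of \<open>V\<close>. For the zero subspace that sphere is empty, hence the case split.\<close>

lemma norm_on_lower_bound: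
  fixes V :: "'b::euclidean_space set"
  assumes N: "norm_on V N" and V: "subspace V"
  obtains c where "c > 0" "\<And>v. v \<in> V \<Longrightarrow> c * norm v \<le> N v"
proof (cases "V \<subseteq> {0}")
  case True
  then show ?thesis
    using N by (intro that[of 1]) (auto simp: norm_on_def)
next
  case False
  define K where "K = V \<inter> sphere 0 1"
  obtain w where w: "w \<in> V" "w \<noteq> 0"
    using False by auto
  have "(1 / norm w) *\<^sub>R w \<in> K"
    using w V by (auto simp: K_def subspace_scale)
  then have "K \<noteq> {}"
    by auto
  moreover have "compact K"
    using closed_subspace[OF V] by (auto simp: K_def intro: closed_Int_compact)
  moreover have "continuous_on K N"
    using norm_on_continuous_on[OF assms] by (rule continuous_on_subset) (auto simp: K_def)
  ultimately obtain z where z: "z \<in> K" "\<And>y. y \<in> K \<Longrightarrow> N z \<le> N y"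
    using continuous_attains_inf by metis
  have "z \<in> V" "z \<noteq> 0"
    using z(1) by (auto simp: K_def)
  then have "N z > 0"
    using N by (metis norm_on_def less_eq_real_def)
  moreover have "N z * norm v \<le> N v" if v: "v \<in> V" for v
  proof (cases "v = 0")
    case True
    then show ?thesis
      using N v by (auto simp: norm_on_def)
  next
    case False
    have "(1 / norm v) *\<^sub>R v \<in> K"
      using v V False by (auto simp: K_def subspace_scale)
    then have "N z \<le> N ((1 / norm v) *\<^sub>R v)"
      by (rule z(2))
    also have "\<dots> = N v / norm v"
      using N v unfolding norm_on_def by simp
    finally show ?thesis
      using False by (simp add: pos_le_divide_eq)
  qed
  ultimately show ?thesis
    by (rule that)
qed

text \<open>The Hoelder inequality for \<open>N\<close> and its dual: \<open>v / N v\<close>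
  competes in the supremum that defines the dual norm.\<close>

lemma inner_le_dual_norm:
  fixes V :: "'b::euclidean_space set"
  assumes N: "norm_on V N" and V: "subspace V" and v: "v \<in> V"
  shows "g \<bullet> v \<le> dual_norm V N g * N v"
proof (cases "v = 0")
  case True
  then show ?thesis
    using N v by (auto simp: norm_on_def)
next
  case False
  then have Nv: "N v > 0"
    using N v by (metis norm_on_def less_eq_real_def)
  obtain c where c: "c > 0" "\<And>v. v \<in> V \<Longrightarrow> c * norm v \<le> N v"
    using norm_on_lower_bound[OF N V] by metis
  \<comment> \<open>A real supremum is an upper bound only for a bounded set. The lower bound on
    \<open>N\<close> puts its unit ball inside the Euclidean ball of radius
    \<open>1 / c\<close>.\<close>
  have "bdd_above ((\<bullet>) g ` {v \<in> V. N v \<le> 1})"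
  proof (rule bdd_aboveI2)
    fix w assume "w \<in> {v \<in> V. N v \<le> 1}"
    then have "c * norm w \<le> 1"
      using c(2)[of w] by auto
    then have "norm w \<le> 1 / c"
      using c(1) by (simp add: pos_le_divide_eq mult.commute)
    then have "norm g * norm w \<le> norm g * (1 / c)"
      by (intro mult_left_mono) auto
    then show "g \<bullet> w \<le> norm g * (1 / c)"
      using norm_cauchy_schwarz[of g w] by linarith
  qed
  moreover have "(1 / N v) *\<^sub>R v \<in> {v \<in> V. N v \<le> 1}"
  proof -
    have "N ((1 / N v) *\<^sub>R v) = \<bar>1 / N v\<bar> * N v"
      using N v unfolding norm_on_def by blast
    then show ?thesis
      using Nv v V by (auto simp: subspace_scale)
  qed
  ultimately have "g \<bullet> ((1 / N v) *\<^sub>R v) \<le> dual_norm V N g"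
    unfolding dual_norm_def by (intro cSUP_upper)
  then show ?thesis
    using Nv by (simp add: pos_divide_le_eq)
qed

section \<open>Strategy sets, profiles and the global norm\<close>

lemma subspace_coord_space: "subspace (coord_space B)"
  by (auto simp: subspace_def coord_space_def)

lemma subspace_joint_space: "subspace (joint_space A)"
  using subspace_coord_space by (auto simp: subspace_def joint_space_def)

lemma convex_mixed_strategies: "convex (mixed_strategies B)"
  by (auto simp: convex_def mixed_strategies_def coord_space_def sum.distrib
      simp flip: sum_distrib_left)

lemma convex_profiles: "convex (profiles A)"
  using convex_mixed_strategies unfolding convex_def profiles_def by fastforce

lemma profiles_diff_in_joint_space:
  "x \<in> profiles A \<Longrightarrow> y \<in> profiles A \<Longrightarrow> x - y \<in> joint_space A"
  by (auto simp: profiles_def joint_space_def mixed_strategies_def coord_space_def)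

text \<open>The global norm is the l2 norm of the vector of block norms, so its triangle inequality
  is the blockwise one followed by Minkowski. The monotonicity step in between needs nonnegative
  block norms.\<close>

lemma norm_on_global_norm:
  fixes A :: "'p::finite \<Rightarrow> 'a::finite set"
  assumes N: "\<And>i. norm_on (coord_space (A i)) (N i)"
  shows "norm_on (joint_space A) (global_norm N)"
proof -
  have L2: "global_norm N v = L2_set (\<lambda>i. N i (v $ i)) UNIV" for v
    by (simp add: global_norm_def L2_set_def)
  have nn: "0 \<le> N i (v $ i)" if "v \<in> joint_space A" for v i
    using N that by (auto simp: norm_on_def joint_space_def)
  show ?thesis
    unfolding norm_on_def
  proof (intro conjI ballI allI)
    fix v :: "real^'a^'p" assume v: "v \<in> joint_space A"
    show "0 \<le> global_norm N v"
      by (simp add: L2)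
    have "N i (v $ i) = 0 \<longleftrightarrow> v $ i = 0" for i
      using N v by (auto simp: norm_on_def joint_space_def)
    then show "global_norm N v = 0 \<longleftrightarrow> v = 0"
      by (simp add: L2 L2_set_eq_0_iff vec_eq_iff)
    fix w :: "real^'a^'p" assume w: "w \<in> joint_space A"
    have "L2_set (\<lambda>i. N i ((v + w) $ i)) UNIV \<le> L2_set (\<lambda>i. N i (v $ i) + N i (w $ i)) UNIV"
    proof (rule L2_set_mono)
      fix i
      have "v + w \<in> joint_space A"
        using v w by (intro subspace_add subspace_joint_space)
      then show "0 \<le> N i ((v + w) $ i)"
        by (rule nn)
      show "N i ((v + w) $ i) \<le> N i (v $ i) + N i (w $ i)"
        using N v w by (auto simp: norm_on_def joint_space_def)
    qed
    also have "\<dots> \<le> L2_set (\<lambda>i. N i (v $ i)) UNIV + L2_set (\<lambda>i. N i (w $ i)) UNIV"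
      by (rule L2_set_triangle_ineq)
    finally show "global_norm N (v + w) \<le> global_norm N v + global_norm N w"
      by (simp add: L2)
  next
    fix c and v :: "real^'a^'p" assume v: "v \<in> joint_space A"
    have "N i ((c *\<^sub>R v) $ i) = \<bar>c\<bar> * N i (v $ i)" for i
      using N v by (auto simp: norm_on_def joint_space_def)
    then show "global_norm N (c *\<^sub>R v) = \<bar>c\<bar> * global_norm N v"
      by (simp add: L2 L2_set_right_distrib)
  qed
qed

section \<open>Descent lemma, and quadratic growth at a maximizer\<close>

lemma descent_lemma:
  fixes f :: "'b::euclidean_space \<Rightarrow> real"
  assumes N: "norm_on V N" and V: "subspace V"
    and S: "convex S" "\<And>v w. v \<in> S \<Longrightarrow> w \<in> S \<Longrightarrow> v - w \<in> V"
    and deriv: "\<And>z. z \<in> S \<Longrightarrow> GDERIV f z :> G z"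
    and smooth: "\<And>v w. v \<in> S \<Longrightarrow> w \<in> S \<Longrightarrow> dual_norm V N (G v - G w) \<le> L * N (v - w)"
    and x: "x \<in> S" and y: "y \<in> S"
  shows "f y \<ge> f x + G x \<bullet> (y - x) - L / 2 * (N (y - x))\<^sup>2"
proof -
  define d where "d = y - x"
  define p where "p = (\<lambda>s::real. x + s *\<^sub>R d)"
  \<comment> \<open>Along the segment from \<open>x\<close> to \<open>y\<close>, \<open>h\<close> is
    \<open>f\<close> minus its linear term at \<open>x\<close> plus the quadratic error allowed by
    smoothness. The claim is exactly \<open>h 0 \<le> h 1\<close>, so it suffices that
    \<open>h\<close> has a nonnegative derivative on [0,1].\<close>
  define h where "h = (\<lambda>s. f (p s) - s * (G x \<bullet> d) + L / 2 * s\<^sup>2 * (N d)\<^sup>2)"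
  have d: "d \<in> V"
    using S(2) x y by (simp add: d_def)
  have "h 0 \<le> h 1"
  proof (rule DERIV_nonneg_imp_nondecreasing[where f = h])
    fix s :: real assume s: "0 \<le> s" "s \<le> 1"
    have "p s = (1 - s) *\<^sub>R x + s *\<^sub>R y"
      by (simp add: p_def d_def algebra_simps)
    then have ps: "p s \<in> S"
      using S(1) x y s by (simp add: convex_alt)
    have f': "(f has_derivative (\<lambda>v. v \<bullet> G (p s))) (at (p s))"
      using deriv[OF ps] by (simp add: gderiv_def)
    have "((\<lambda>s. f (p s)) has_derivative (\<lambda>r. (r *\<^sub>R d) \<bullet> G (p s))) (at s)"
      by (rule has_derivative_compose[where g = f and f = p, OF _ f'])
        (auto simp: p_def intro!: derivative_eq_intros)
    then have "((\<lambda>s. f (p s)) has_real_derivative (G (p s) \<bullet> d)) (at s)"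
      by (simp add: has_field_derivative_def inner_commute mult_commute_abs)
    then have h': "(h has_real_derivative (G (p s) \<bullet> d - G x \<bullet> d + L * s * (N d)\<^sup>2)) (at s)"
      unfolding h_def by (auto intro!: derivative_eq_intros)
    \<comment> \<open>The gradient has moved by at most \<open>L\<close> times the distance
      travelled, \<open>s * N d\<close>; paired with \<open>d\<close> this gives
      \<open>L * s * (N d)\<^sup>2\<close>, the derivative of the quadratic term of
      \<open>h\<close>.\<close>
    have "x - p s = (- s) *\<^sub>R d"
      by (simp add: p_def)
    moreover have "N ((- s) *\<^sub>R d) = \<bar>- s\<bar> * N d"
      using N d unfolding norm_on_def by blast
    ultimately have Ns: "N (x - p s) = s * N d"
      using s by simp
    have "(G x - G (p s)) \<bullet> d \<le> dual_norm V N (G x - G (p s)) * N d"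
      by (rule inner_le_dual_norm[OF N V d])
    also have "\<dots> \<le> L * N (x - p s) * N d"
      using smooth[OF x ps] N d by (intro mult_right_mono) (auto simp: norm_on_def)
    also have "\<dots> = L * s * (N d)\<^sup>2"
      by (simp add: Ns power2_eq_square)
    finally have "0 \<le> G (p s) \<bullet> d - G x \<bullet> d + L * s * (N d)\<^sup>2"
      by (simp add: inner_diff_left)
    with h' show "\<exists>D. (h has_real_derivative D) (at s) \<and> 0 \<le> D"
      by blast
  qed simp
  moreover have "p 0 = x" "p 1 = y"
    by (simp_all add: p_def d_def)
  ultimately show ?thesis
    by (simp add: h_def d_def)
qed

text \<open>Optimality is tested at points of the segment from \<open>z\<close> to \<open>y\<close>
  close to \<open>z\<close>. This needs no derivative of \<open>f\<close>: strong convexity in its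
  chord form suffices.\<close>

lemma arg_max_quadratic_growth:
  fixes f :: "'b::real_inner \<Rightarrow> real"
  assumes sc: "strongly_convex_on S N \<mu> f" and S: "convex S" and "k \<ge> 0"
    and z: "is_arg_max (\<lambda>y. y \<bullet> g - k * f y) (\<lambda>y. y \<in> S) z" and y: "y \<in> S"
  shows "z \<bullet> g - k * f z \<ge> y \<bullet> g - k * f y + k * \<mu> / 2 * (N (y - z))\<^sup>2"
proof -
  define h where "h = (\<lambda>y. y \<bullet> g - k * f y)"
  define q where "q = k * \<mu> / 2 * (N (y - z))\<^sup>2"
  have zS: "z \<in> S" and max: "\<And>w. w \<in> S \<Longrightarrow> h w \<le> h z"
    using z by (auto simp: is_arg_max_linorder h_def)
  \<comment> \<open>At \<open>w\<close> the objective exceeds the chord by at least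
    \<open>c * (1 - c) * q\<close>, yet stays below \<open>h z\<close>. Dividing by \<open>c\<close>
    leaves the factor \<open>1 - c\<close>.\<close>
  have ineq: "h z - h y \<ge> (1 - c) * q" if c: "0 < c" "c < 1" for c
  proof -
    define w where "w = c *\<^sub>R y + (1 - c) *\<^sub>R z"
    have "w \<in> S"
      using S zS y c by (simp add: w_def convex_def)
    then have "h w \<le> h z"
      by (rule max)
    moreover have "k * f w \<le> k * (c * f y + (1 - c) * f z - \<mu> / 2 * c * (1 - c) * (N (y - z))\<^sup>2)"
      using sc y zS c \<open>k \<ge> 0\<close> unfolding strongly_convex_on_def w_def
      by (intro mult_left_mono) auto
    then have "h w \<ge> c * h y + (1 - c) * h z + c * ((1 - c) * q)"
      by (simp add: h_def q_def w_def inner_add_left algebra_simps)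
    ultimately have "c * ((1 - c) * q) \<le> c * (h z - h y)"
      by (simp add: algebra_simps)
    then show ?thesis
      using c by simp
  qed
  \<comment> \<open>Letting \<open>c\<close> tend to 0 from the right recovers all of
    \<open>q\<close>; any fixed \<open>c\<close> would lose part of the constant.\<close>
  have "((\<lambda>c. (1 - c) * q) \<longlongrightarrow> (1 - 0) * q) (at_right 0)"
    by (intro tendsto_intros)
  moreover have "eventually (\<lambda>c. (1 - c) * q \<le> h z - h y) (at_right 0)"
    using ineq by (intro eventually_at_rightI[of 0 1]) auto
  ultimately have "(1 - 0) * q \<le> h z - h y"
    by (rule tendsto_upperbound) simp
  then show ?thesis
    by (simp add: h_def q_def)
qed

section \<open>Boundedness and range of the potential\<close>

lemma multilinear_on_profiles_bounded:
  assumes "multilinear_on_profiles A \<Phi>" and x: "x \<in> profiles A"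
  shows "\<bar>\<Phi> x\<bar> \<le> (\<Sum>s\<in>Pi\<^sub>E UNIV A. \<bar>\<Phi> (pure_profile s)\<bar>)"
proof -
  have "\<Phi> x = (\<Sum>s\<in>Pi\<^sub>E UNIV A. (\<Prod>i\<in>UNIV. x $ i $ s i) * \<Phi> (pure_profile s))"
    using assms unfolding multilinear_on_profiles_def by blast
  also have "\<bar>\<dots>\<bar> \<le> (\<Sum>s\<in>Pi\<^sub>E UNIV A. \<bar>(\<Prod>i\<in>UNIV. x $ i $ s i) * \<Phi> (pure_profile s)\<bar>)"
    by (rule sum_abs)
  also have "\<dots> \<le> (\<Sum>s\<in>Pi\<^sub>E UNIV A. \<bar>\<Phi> (pure_profile s)\<bar>)"
  proof (rule sum_mono)
    fix s assume s: "s \<in> Pi\<^sub>E UNIV A"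
    \<comment> \<open>Each probability lies in [0,1], hence so does the weight of every pure
      profile. The crude bound by the sum of all pure values is enough, as only finiteness
      matters.\<close>
    have "0 \<le> x $ i $ s i \<and> x $ i $ s i \<le> 1" for i
    proof -
      have xi: "\<forall>a\<in>A i. 0 \<le> x $ i $ a" "(\<Sum>a\<in>A i. x $ i $ a) = 1" and si: "s i \<in> A i"
        using x s by (auto simp: profiles_def mixed_strategies_def)
      have "x $ i $ s i \<le> (\<Sum>a\<in>A i. x $ i $ a)"
        using xi(1) si by (intro member_le_sum) auto
      then show ?thesis
        using xi si by simp
    qed
    then have "\<bar>\<Prod>i\<in>UNIV. x $ i $ s i\<bar> \<le> 1"
      by (simp add: abs_prod prod_le_1)
    then show "\<bar>(\<Prod>i\<in>UNIV. x $ i $ s i) * \<Phi> (pure_profile s)\<bar> \<le> \<bar>\<Phi> (pure_profile s)\<bar>"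
      by (simp add: abs_mult mult_left_le_one_le)
  qed
  finally show ?thesis .
qed

text \<open>Boundedness on profiles is what makes \<open>SUP\<close> and \<open>INF\<close> genuine
  bounds for the values of \<open>\<Phi>\<close>.\<close>

lemma diff_le_potential_range:
  assumes "multilinear_on_profiles A \<Phi>" and "x \<in> profiles A" and "y \<in> profiles A"
  shows "\<Phi> x - \<Phi> y \<le> potential_range A \<Phi>"
proof -
  let ?M = "\<Sum>s\<in>Pi\<^sub>E UNIV A. \<bar>\<Phi> (pure_profile s)\<bar>"
  have bound: "\<bar>\<Phi> z\<bar> \<le> ?M" if "z \<in> profiles A" for z
    using assms(1) that by (rule multilinear_on_profiles_bounded)
  have "bdd_above (\<Phi> ` profiles A)"
    by (rule bdd_aboveI2[of _ _ ?M]) (use bound in fastforce)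
  then have "\<Phi> x \<le> (SUP x\<in>profiles A. \<Phi> x)"
    using assms(2) by (intro cSUP_upper)
  moreover have "bdd_below (\<Phi> ` profiles A)"
    by (rule bdd_belowI2[of _ "- ?M"]) (use bound in fastforce)
  then have "(INF x\<in>profiles A. \<Phi> x) \<le> \<Phi> y"
    using assms(3) by (intro cINF_lower)
  ultimately show ?thesis
    by (simp add: potential_range_def)
qed

section \<open>Progress of the FTRL iterates\<close>

lemma FTRL_in_profiles:
  assumes "FTRL A R \<eta> \<Phi> x" and "t \<ge> 1"
  shows "x t \<in> profiles A"
proof -
  \<comment> \<open>\<open>FTRL\<close> constrains only indices of the form \<open>t + 1\<close>, so
    a round \<open>t\<close> from 1 on is reached through \<open>t - 1\<close>.\<close>
  have "x (t - 1 + 1) $ i \<in> mixed_strategies (A i)" for i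
    using assms(1) unfolding FTRL_def is_arg_max_def by blast
  then show ?thesis
    using assms(2) by (simp add: profiles_def)
qed

text \<open>Each of the two iterates is tested against the other's objective. On adding, the
  regularizer terms cancel, the cumulative utilities leave only the utility of round
  \<open>t\<close>, and the two growth terms of size \<open>1 / (2 * \<eta>)\<close> combine to
  \<open>1 / \<eta>\<close>.\<close>

lemma FTRL_inner_utility_ge:
  assumes ftrl: "FTRL A R \<eta> \<Phi> x" and "\<eta> > 0" and t: "t \<ge> 1"
    and N: "norm_on (coord_space (A i)) (N i)"
    and sc: "strongly_convex_on (mixed_strategies (A i)) (N i) 1 (R i)"
  shows "gradient \<Phi> (x t) $ i \<bullet> (x (t + 1) $ i - x t $ i)
    \<ge> 1 / \<eta> * (N i (x (t + 1) $ i - x t $ i))\<^sup>2"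
proof -
  define G where "G = (\<lambda>t. \<Sum>\<tau>=1..t. gradient \<Phi> (x \<tau>) $ i)"
  have opt: "is_arg_max (\<lambda>y. y \<bullet> G t - 1 / \<eta> * R i y)
      (\<lambda>y. y \<in> mixed_strategies (A i)) (x (t + 1) $ i)" for t
    using ftrl unfolding FTRL_def G_def by blast
  have mem: "x (t + 1) $ i \<in> mixed_strategies (A i)" "x t $ i \<in> mixed_strategies (A i)"
    using FTRL_in_profiles[OF ftrl] t by (auto simp: profiles_def)
  then have "x (t + 1) $ i - x t $ i \<in> coord_space (A i)"
    by (auto simp: mixed_strategies_def coord_space_def)
  \<comment> \<open>The two growth inequalities measure the step in opposite directions; homogeneity
    with factor -1 identifies the two norms.\<close>
  then have "N i ((-1) *\<^sub>R (x (t + 1) $ i - x t $ i)) = \<bar>-1\<bar> * N i (x (t + 1) $ i - x t $ i)"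
    using N unfolding norm_on_def by blast
  then have sym: "N i (x t $ i - x (t + 1) $ i) = N i (x (t + 1) $ i - x t $ i)"
    by simp
  have "G t = G (t - 1) + gradient \<Phi> (x t) $ i"
    using t by (cases t) (auto simp: G_def)
  moreover have "x (t + 1) $ i \<bullet> G t - 1 / \<eta> * R i (x (t + 1) $ i)
      \<ge> x t $ i \<bullet> G t - 1 / \<eta> * R i (x t $ i)
        + 1 / \<eta> * 1 / 2 * (N i (x t $ i - x (t + 1) $ i))\<^sup>2"
    using \<open>\<eta> > 0\<close>
    by (intro arg_max_quadratic_growth[OF sc convex_mixed_strategies _ opt mem(2)]) simp
  \<comment> \<open>Here the optimality condition is the one indexed by \<open>t - 1\<close>. For
    \<open>t = 1\<close> the sum \<open>G 0\<close> is empty, and \<open>x 1\<close> minimizes the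
    regularizer.\<close>
  moreover have "x t $ i \<bullet> G (t - 1) - 1 / \<eta> * R i (x t $ i)
      \<ge> x (t + 1) $ i \<bullet> G (t - 1) - 1 / \<eta> * R i (x (t + 1) $ i)
        + 1 / \<eta> * 1 / 2 * (N i (x (t + 1) $ i - x t $ i))\<^sup>2"
    using \<open>\<eta> > 0\<close> opt[of "t - 1"] t
    by (intro arg_max_quadratic_growth[OF sc convex_mixed_strategies _ _ mem(1)]) simp_all
  ultimately show ?thesis
    using sym by (simp add: inner_add_right inner_diff_right inner_commute)
qed

theorem proposition3p2:
  fixes A :: "'p::finite \<Rightarrow> 'a::finite set"
    and u :: "'p \<Rightarrow> real^'a^'p \<Rightarrow> real"
    and \<Phi> :: "real^'a^'p \<Rightarrow> real"
    and R N :: "'p \<Rightarrow> real^'a \<Rightarrow> real"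
    and L \<eta> :: real
    and x :: "nat \<Rightarrow> real^'a^'p"
  assumes "\<And>i. A i \<noteq> {}"
    and "potential_game A u \<Phi>"
    and "multilinear_on_profiles A \<Phi>"
    and "C1_around (profiles A) \<Phi>"
    and "\<And>i. norm_on (coord_space (A i)) (N i)"
    and "\<And>i. C1_around (mixed_strategies (A i)) (R i)"
    and "\<And>i. strongly_convex_on (mixed_strategies (A i)) (N i) 1 (R i)"
    and "L > 0"
    and "smooth_potential A N L \<Phi>"
    and "\<eta> > 0" and "\<eta> \<le> 1 / L"
    and "FTRL A R \<eta> \<Phi> x"
  shows "(\<forall>t\<ge>1. \<Phi> (x (t + 1)) - \<Phi> (x t) \<ge> 1 / (2 * \<eta>) * (global_norm N (x (t + 1) - x t))\<^sup>2) \<and>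
         (\<forall>T\<ge>1. (\<Sum>t=1..T. \<Sum>i\<in>UNIV. (N i (x (t + 1) $ i - x t $ i))\<^sup>2)
                  \<le> 2 * \<eta> * potential_range A \<Phi>)"
proof -
  let ?d = "\<lambda>t. x (t + 1) - x t"
  have N: "norm_on (joint_space A) (global_norm N)"
    using assms(5) by (rule norm_on_global_norm)
  have mem: "x t \<in> profiles A" if "t \<ge> 1" for t
    using assms(12) that by (rule FTRL_in_profiles)
  have deriv: "GDERIV \<Phi> z :> gradient \<Phi> z" if "z \<in> profiles A" for z
    using assms(4) that unfolding C1_around_def by blast
  have sq: "(global_norm N v)\<^sup>2 = (\<Sum>i\<in>UNIV. (N i (v $ i))\<^sup>2)" for v
    by (simp add: global_norm_def sum_nonneg)
  have step: "1 / (2 * \<eta>) * (global_norm N (?d t))\<^sup>2 \<le> \<Phi> (x (t + 1)) - \<Phi> (x t)"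
    if t: "t \<ge> 1" for t
  proof -
    have "1 / \<eta> * (global_norm N (?d t))\<^sup>2
        = (\<Sum>i\<in>UNIV. 1 / \<eta> * (N i (x (t + 1) $ i - x t $ i))\<^sup>2)"
      by (simp add: sq sum_distrib_left)
    also have "\<dots> \<le> (\<Sum>i\<in>UNIV. gradient \<Phi> (x t) $ i \<bullet> (x (t + 1) $ i - x t $ i))"
      using assms(12,10) t assms(5,7) by (intro sum_mono FTRL_inner_utility_ge)
    \<comment> \<open>Updates are simultaneous: every player's block is taken from the gradient at
      the same profile \<open>x t\<close>, so the blocks add up to one full inner product.\<close>
    also have "\<dots> = gradient \<Phi> (x t) \<bullet> ?d t"
      by (simp add: inner_vec_def)
    finally have "1 / \<eta> * (global_norm N (?d t))\<^sup>2 \<le> gradient \<Phi> (x t) \<bullet> ?d t" .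
    moreover have "\<Phi> (x (t + 1)) \<ge> \<Phi> (x t) + gradient \<Phi> (x t) \<bullet> ?d t
        - L / 2 * (global_norm N (?d t))\<^sup>2"
      using assms(9) mem t unfolding smooth_potential_def
      by (intro descent_lemma[OF N subspace_joint_space convex_profiles
            profiles_diff_in_joint_space deriv]) auto
    moreover have "L / 2 * (global_norm N (?d t))\<^sup>2 \<le> 1 / (2 * \<eta>) * (global_norm N (?d t))\<^sup>2"
      using assms(8,10,11) by (intro mult_right_mono) (auto simp: field_simps)
    ultimately show ?thesis
      by simp
  qed
  have "(\<Sum>t=1..T. \<Sum>i\<in>UNIV. (N i (x (t + 1) $ i - x t $ i))\<^sup>2) \<le> 2 * \<eta> * potential_range A \<Phi>"
    if T: "T \<ge> 1" for T
  proof -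
    have "(\<Sum>t=1..T. \<Sum>i\<in>UNIV. (N i (x (t + 1) $ i - x t $ i))\<^sup>2)
        = (\<Sum>t=1..T. (global_norm N (?d t))\<^sup>2)"
      by (simp add: sq)
    also have "\<dots> \<le> (\<Sum>t=1..T. 2 * \<eta> * (\<Phi> (x (t + 1)) - \<Phi> (x t)))"
    proof (rule sum_mono)
      fix t assume "t \<in> {1..T}"
      then show "(global_norm N (?d t))\<^sup>2 \<le> 2 * \<eta> * (\<Phi> (x (t + 1)) - \<Phi> (x t))"
        using step[of t] assms(10) by (simp add: pos_divide_le_eq mult.commute)
    qed
    also have "\<dots> = 2 * \<eta> * (\<Sum>t=1..T. \<Phi> (x (Suc t)) - \<Phi> (x t))"
      by (simp add: sum_distrib_left)
    also have "\<dots> = 2 * \<eta> * (\<Phi> (x (Suc T)) - \<Phi> (x 1))"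
      using T by (subst sum_Suc_diff) auto
    \<comment> \<open>The telescoped sum starts at round 1, so both remaining iterates are profiles
      and their potential gap is at most the range.\<close>
    also have "\<dots> \<le> 2 * \<eta> * potential_range A \<Phi>"
      using assms(3,10) mem by (intro mult_left_mono diff_le_potential_range) auto
    finally show ?thesis .
  qed
  with step show ?thesis
    by blast
qed

end
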